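(* For every integer $n\ge 2$, there exist an integer $b$ with $b\le 2^y-1$ for some integer $y\le\lceil\sqrt{2n}\rceil+1$, such that the base-$b$ representation of $2^n$ has binomial form, i.e. there are integers $k\ge 0$ and $\alpha\ge 1$ with $2^n=\sum_{i=0}^k\alpha\binom{k}{i}b^i$ and $\alpha\binom{k}{i}<b$ for all $i$.
   Context: For an integer $b>1$, every positive integer $N$ can be written uniquely as $N=\sum_{i=0}^k c_i b^i$ with integers $0\le c_i<b$ and $c_k>0$. This representation has binomial form if $c_i=\alpha\binom{k}{i}$ for all $i$, for some positive integer $\alpha$. *)

theory Defs
  imports Complex_Main
begin

text \<open>
  The digit function \<open>c\<close> is constrained only on \<open>{0..k}\<close>, where \<open>k\<close> is the position of the leading
  digit. The requirement \<open>0 < c k < b\<close> already forces \<open>b > 1\<close>.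
\<close>
definition base_representation :: "int \<Rightarrow> int \<Rightarrow> nat \<Rightarrow> (nat \<Rightarrow> int) \<Rightarrow> bool" where
  "base_representation b N k c \<longleftrightarrow>
     N = (\<Sum>i=0..k. c i * b ^ i) \<and> (\<forall>i\<le>k. 0 \<le> c i \<and> c i < b) \<and> c k > 0"

definition has_binomial_form :: "int \<Rightarrow> int \<Rightarrow> bool" where
  "has_binomial_form b N \<longleftrightarrow>
     (\<exists>k c. base_representation b N k c \<and>
        (\<exists>\<alpha>::int. \<alpha> > 0 \<and> (\<forall>i\<le>k. c i = \<alpha> * int (k choose i))))"

lemma has_binomial_form_iff:
  "has_binomial_form b N \<longleftrightarrow>
     (\<exists>(k::nat) (\<alpha>::int). \<alpha> \<ge> 1 \<and> N = (\<Sum>i=0..k. \<alpha> * int (k choose i) * b ^ i) \<and>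
        (\<forall>i\<le>k. \<alpha> * int (k choose i) < b))" (is "?L \<longleftrightarrow> ?R")
proof
  assume ?L
  then obtain k c \<alpha> where *: "base_representation b N k c" "\<alpha> > 0"
      "\<forall>i\<le>k. c i = \<alpha> * int (k choose i)"
    unfolding has_binomial_form_def by blast
  have "(\<Sum>i=0..k. c i * b ^ i) = (\<Sum>i=0..k. \<alpha> * int (k choose i) * b ^ i)"
    by (rule sum.cong) (use * in auto)
  moreover have "\<forall>i\<le>k. \<alpha> * int (k choose i) < b"
    using * unfolding base_representation_def by metis
  ultimately show ?R
    using * unfolding base_representation_def by (intro exI[of _ k] exI[of _ \<alpha>]) auto
next
  assume ?R
  then obtain k :: nat and \<alpha> :: int where "\<alpha> \<ge> 1"
      "N = (\<Sum>i=0..k. \<alpha> * int (k choose i) * b ^ i)" "\<forall>i\<le>k. \<alpha> * int (k choose i) < b"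
    by blast
  then show ?L
    unfolding has_binomial_form_def base_representation_def
    by (intro exI[of _ k] exI[of _ "\<lambda>i. \<alpha> * int (k choose i)"] conjI exI[of _ \<alpha>]) auto
qed

end

theory Submission
  imports Defs
begin

text \<open>
  If \<open>b + 1 = 2 ^ z\<close> and \<open>n = k z + r\<close>, the binomial theorem gives
  \<open>2 ^ n = 2 ^ r (b + 1) ^ k = (\<Sum>i\<le>k. 2 ^ r (k choose i) b ^ i)\<close>. Since
  \<open>k choose i \<le> 2 ^ (k - 1)\<close>, these coefficients are digits in base \<open>b\<close> as soon as
  \<open>r + k \<le> z\<close>. Dividing \<open>n\<close> by the largest \<open>k\<close> with \<open>k (2 k - 1) \<le> n\<close> ensures this, as then
  \<open>r \<le> k - 1\<close> and \<open>z \<ge> 2 k - 1\<close>, while maximality of \<open>k\<close> gives \<open>z \<le> 2 k + 3\<close> and hence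
  \<open>(z - 2)\<^sup>2 < 2 k z \<le> 2 n\<close>.
\<close>

text \<open>The factor 2 saved over \<open>binomial_le_pow2\<close> keeps a digit at most
  \<open>2 ^ (z - 1)\<close>, hence below the base \<open>2 ^ z - 1\<close>.\<close>

lemma binomial_Suc_le_pow2: "Suc k choose i \<le> 2 ^ k"
proof (induction k arbitrary: i)
  case 0
  then show ?case using binomial_le_pow2[of 0 "i - 1"] by (cases i) auto
next
  case (Suc k)
  show ?case
  proof (cases i)
    case (Suc j)
    have "Suc (Suc k) choose i = (Suc k choose j) + (Suc k choose Suc j)"
      using Suc by simp
    also have "\<dots> \<le> 2 ^ k + 2 ^ k"
      by (intro add_mono Suc.IH)
    finally show ?thesis by simp
  qed simp
qed

lemma has_binomial_form_pow2:
  assumes "0 < k" "2 \<le> z" "r + k \<le> z"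
  shows "has_binomial_form (2 ^ z - 1) (2 ^ (k * z + r))"
proof -
  have "(2::int) ^ (k * z + r) = 2 ^ r * ((2 ^ z - 1) + 1) ^ k"
    by (simp add: power_add mult.commute[of k] power_mult)
  also have "\<dots> = (\<Sum>i=0..k. 2 ^ r * int (k choose i) * (2 ^ z - 1) ^ i)"
    by (subst binomial_ring) (simp add: sum_distrib_left mult.assoc atLeast0AtMost)
  finally have expansion:
    "(2::int) ^ (k * z + r) = (\<Sum>i=0..k. 2 ^ r * int (k choose i) * (2 ^ z - 1) ^ i)" .
  have digit: "2 ^ r * int (k choose i) < 2 ^ z - 1" for i
  proof -
    have "k choose i \<le> 2 ^ (k - 1)"
      using binomial_Suc_le_pow2[of "k - 1" i] \<open>0 < k\<close> by simp
    then have "int (k choose i) \<le> int (2 ^ (k - 1))"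
      by (simp only: of_nat_le_iff)
    then have "2 ^ r * int (k choose i) \<le> 2 ^ r * 2 ^ (k - 1)"
      by simp
    also have "\<dots> = 2 ^ (r + (k - 1))"
      by (simp add: power_add)
    also have "\<dots> \<le> 2 ^ (z - 1)"
      using assms by (intro power_increasing) auto
    \<comment> \<open>The gap is \<open>2 ^ (z - 1) - 1\<close>, positive because
      \<open>2 \<le> z\<close>.\<close>
    also have "\<dots> < 2 ^ z - (1::int)"
    proof -
      have "(2::int) ^ 1 \<le> 2 ^ (z - 1)"
        using assms by (intro power_increasing) auto
      moreover have "(2::int) ^ z = 2 * 2 ^ (z - 1)"
        using assms by (simp flip: power_Suc)
      ultimately show ?thesis by simp
    qed
    finally show ?thesis .
  qed
  show ?thesis
    unfolding has_binomial_form_iff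
    using expansion digit by (intro exI[of _ k] exI[of _ "2 ^ r"]) auto
qed

lemma exists_short_division:
  assumes "2 \<le> n"
  obtains k z r :: nat where "n = k * z + r" "0 < k" "2 \<le> z" "r + k \<le> z" "z \<le> 2 * k + 3"
proof -
  define P where "P k \<longleftrightarrow> k * (2 * k - 1) \<le> n" for k
  define k where "k = (GREATEST k. P k)"
  have P_1: "P 1"
    using assms by (simp add: P_def)
  \<comment> \<open>This bound makes the \<open>GREATEST\<close> well defined.\<close>
  have P_le: "j \<le> n" if "P j" for j
    using that by (cases j) (auto simp: P_def)
  have "P k"
    unfolding k_def by (rule GreatestI_nat[of P 1 n]) (use P_1 P_le in auto)
  have P_le_k: "j \<le> k" if "P j" for j
    unfolding k_def using Greatest_le_nat[of P j n] that P_le by blast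
  have "1 \<le> k"
    using P_1 by (rule P_le_k)
  have "\<not> P (Suc k)"
    using P_le_k[of "Suc k"] by auto
  then have n_less: "n < (k + 1) * (2 * k + 1)"
    by (simp add: P_def)
  define z where "z = n div k"
  have z_ge: "2 * k - 1 \<le> z"
    using \<open>P k\<close> \<open>1 \<le> k\<close>
    by (simp add: z_def P_def less_eq_div_iff_mult_less_eq mult.commute)
  \<comment> \<open>\<open>2 k^2 + 3 k + 1 \<le> 2 k^2 + 4 k\<close> as
    \<open>1 \<le> k\<close>.\<close>
  have "n < (2 * k + 4) * k"
    using n_less \<open>1 \<le> k\<close> by (simp add: algebra_simps)
  then have z_le: "z \<le> 2 * k + 3"
    using \<open>1 \<le> k\<close> div_less_iff_less_mult[of k n "2 * k + 4"] by (simp add: z_def)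
  \<comment> \<open>For \<open>k = 1\<close>, \<open>z_ge\<close> gives only
    \<open>1 \<le> z\<close>, but then \<open>z = n\<close>.\<close>
  have "2 \<le> z"
    using z_ge assms \<open>1 \<le> k\<close> by (cases "k = 1") (auto simp: z_def)
  moreover have "n mod k + k \<le> z"
    using z_ge \<open>1 \<le> k\<close> mod_less_divisor[of k n] by linarith
  ultimately show ?thesis
    using that[of k z "n mod k"] \<open>1 \<le> k\<close> z_le by (simp add: z_def)
qed

theorem theorem2p4:
  fixes n :: nat
  assumes "n \<ge> 2"
  shows "\<exists>b::int. b > 1 \<and>
           (\<exists>y::int. y \<le> \<lceil>sqrt (2 * real n)\<rceil> + 1 \<and> real_of_int b \<le> 2 powi y - 1) \<and>
           has_binomial_form b (2 ^ n)"
proof -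
  obtain k z r :: nat where
    n: "n = k * z + r" and k: "0 < k" and z: "2 \<le> z" "r + k \<le> z" "z \<le> 2 * k + 3"
    using exists_short_division[OF assms] .
  have "(real z - 2)\<^sup>2 \<le> (2 * real k + 1) * (real z - 2)"
    unfolding power2_eq_square using z by (intro mult_right_mono) auto
  \<comment> \<open>After expansion this is \<open>z < 4 k + 2\<close>, which follows from
    \<open>z \<le> 2 k + 3\<close> and \<open>1 \<le> k\<close>.\<close>
  also have "\<dots> < 2 * (real k * real z)"
    using z k by (simp add: algebra_simps)
  also have "\<dots> \<le> 2 * real n"
    by (simp add: n)
  finally have "real z - 2 < sqrt (2 * real n)"
    by (rule real_less_rsqrt)
  \<comment> \<open>Strictness gains one: the integer \<open>z - 2\<close> lies strictly below the
    ceiling.\<close>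
  then have "int z \<le> \<lceil>sqrt (2 * real n)\<rceil> + 1"
    by linarith
  moreover have "(1::int) < 2 ^ z - 1"
    using power_increasing[of 2 z "2::int"] z by simp
  moreover have "has_binomial_form (2 ^ z - 1) (2 ^ n)"
    using has_binomial_form_pow2[OF k z(1,2)] n by simp
  ultimately show ?thesis
    by (intro exI[of _ "2 ^ z - 1"] conjI exI[of _ "int z"]) simp_all
qed

end
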